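(* Let $T=\{x_\alpha:\alpha<\aleph_1\}\subseteq[\mathbb{N}]^\infty$ be an unbounded tower. Then the space $C_p(T\cup\mathrm{Fin})$ is productively Fréchet–Urysohn. In particular, the space $T\cup\mathrm{Fin}$ is productively $\gamma$.
   Context: Identify $P(\mathbb{N})$ with the Cantor space $\{0,1\}^{\mathbb{N}}$ via characteristic functions; $[\mathbb{N}]^\infty$ and $\mathrm{Fin}$ denote the infinite and the finite subsets of $\mathbb{N}$, and $T\cup\mathrm{Fin}$ carries the subspace topology of $P(\mathbb{N})$. An element $x\in[\mathbb{N}]^\infty$ is identified with the increasing function in $\mathbb{N}^{\mathbb{N}}$ enumerating it; a set of infinite subsets of $\mathbb{N}$ is unbounded if it is unbounded in $\mathbb{N}^{\mathbb{N}}$ with respect to $\le^*$ (eventual domination). An enumerated set $\{x_\alpha:\alpha<\kappa\}$ is a tower if $x_\beta\subseteq^* x_\alpha$ (i.e., $x_\beta\setminus x_\alpha$ is finite) whenever $\alpha<\beta<\kappa$. For a Tychonoff space $X$, $C_p(X)$ is the space of continuous real-valued functions on $X$ with the topology of pointwise convergence. A space is Fréchet–Urysohn if every point in the closure of a set is the limit of a sequence of elements of that set. A cover of $X$ is a family $\mathcal{U}$ with $X=\bigcup\mathcal{U}$ but $X\notin\mathcal U$ (X not covered by a single member). An open cover $\mathcal U$ is an $\omega$-cover if every finite subset of $X$ is contained in some member of $\mathcal U$, and a $\gamma$-cover if it is infinite and each point of $X$ belongs to all but finitely many members. $X$ is a $\gamma$-space if every open $\omega$-cover of $X$ contains a $\gamma$-cover.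 For a property $P$, a space $X$ is productively $P$ if $X\times Y$ has $P$ for every space $Y$ with $P$.
   Formalization: "Productively Fréchet–Urysohn" is taken to mean that the product with every strongly Fréchet–Urysohn Y is Fréchet–Urysohn; for all Fréchet–Urysohn Y the claim fails (Y the sequential fan, since C_p contains a copy of the real line). *)

theory Defs
  imports "HOL-Analysis.Analysis" "HOL-Library.Infinite_Set"
begin

section \<open>Sets of natural numbers\<close>

text \<open>The Cantor space topology on \<open>P(\<nat>)\<close>: the topology induced by the
  bijection of \<open>P(\<nat>)\<close> with \<open>{0,1}\<^sup>\<nat>\<close> given by characteristic functions.\<close>

definition cantor_topology :: "nat set topology" where
  "cantor_topology =
     pullback_topology UNIV (\<lambda>A n. n \<in> A)
       (product_topology (\<lambda>_. discrete_topology (UNIV :: bool set)) UNIV)"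

definition Fin :: "nat set set" where
  "Fin = {A. finite A}"

definition almost_subset :: "nat set \<Rightarrow> nat set \<Rightarrow> bool" (infix \<open>\<subseteq>*\<close> 50) where
  "A \<subseteq>* B \<longleftrightarrow> finite (A - B)"

definition eventually_dominated :: "(nat \<Rightarrow> nat) \<Rightarrow> (nat \<Rightarrow> nat) \<Rightarrow> bool" (infix \<open>\<le>*\<close> 50) where
  "f \<le>* g \<longleftrightarrow> (\<forall>\<^sub>F n in sequentially. f n \<le> g n)"

text \<open>An infinite set is identified with its increasing enumeration, which is
  \<^const>\<open>enumerate\<close>.\<close>

definition unbounded_sets :: "nat set set \<Rightarrow> bool" where
  "unbounded_sets S \<longleftrightarrow> (\<nexists>g. \<forall>A\<in>S. enumerate A \<le>* g)"

text \<open>The ordinal \<open>\<aleph>\<^sub>1\<close> is represented by a reflexive well-order of that order type;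
  the ordinals below \<open>\<aleph>\<^sub>1\<close> are the elements of its field.\<close>

definition aleph1 :: "nat set rel" where
  "aleph1 = cardSuc natLeq"

text \<open>A tower indexed by the ordinal represented by the well-order \<open>r\<close>. The enumeration
  need not be injective.\<close>

definition tower :: "'i rel \<Rightarrow> ('i \<Rightarrow> nat set) \<Rightarrow> bool" where
  "tower r x \<longleftrightarrow>
     (\<forall>\<alpha>\<in>Field r. infinite (x \<alpha>)) \<and>
     (\<forall>\<alpha> \<beta>. (\<alpha>, \<beta>) \<in> r \<and> \<alpha> \<noteq> \<beta> \<longrightarrow> x \<beta> \<subseteq>* x \<alpha>)"

section \<open>Function spaces and the Frechet--Urysohn property\<close>

text \<open>The elements of \<open>Cp X\<close> are the continuous real-valued functions on the points of \<open>X\<close>,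
  represented by functions that are \<^const>\<open>undefined\<close> outside \<open>topspace X\<close>.\<close>

definition Cp :: "'a topology \<Rightarrow> ('a \<Rightarrow> real) topology" where
  "Cp X = subtopology (product_topology (\<lambda>_. euclideanreal) (topspace X))
            {f. continuous_map X euclideanreal f}"

definition frechet_urysohn :: "'a topology \<Rightarrow> bool" where
  "frechet_urysohn X \<longleftrightarrow>
     (\<forall>A p. A \<subseteq> topspace X \<and> p \<in> X closure_of A \<longrightarrow>
        (\<exists>s. (\<forall>n::nat. s n \<in> A) \<and> limitin X s p sequentially))"

definition strongly_frechet_urysohn :: "'a topology \<Rightarrow> bool" where
  "strongly_frechet_urysohn X \<longleftrightarrow>
     (\<forall>A p. decseq A \<and> (\<forall>n::nat. A n \<subseteq> topspace X \<and> p \<in> X closure_of A n) \<longrightarrow>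
        (\<exists>s. (\<forall>n. s n \<in> A n) \<and> limitin X s p sequentially))"

text \<open>Following Jordan and Mynard, the second factor \<open>Y\<close> ranges over the strongly
  Frechet--Urysohn spaces. It cannot range over all Frechet--Urysohn spaces: for nonempty \<open>X\<close>,
  \<open>Cp X \<times> Y\<close> being Frechet--Urysohn implies that \<open>Y\<close> is strongly so (\<open>Cp X\<close> contains a
  copy of the real line), and the sequential fan is Frechet--Urysohn but not strongly so.

  The type argument fixes the type of the points of \<open>Y\<close>; a type variable
  there makes \<open>Y\<close> range over spaces on an arbitrary type.\<close>

definition productively_frechet_urysohn :: "'b itself \<Rightarrow> 'a topology \<Rightarrow> bool" where
  "productively_frechet_urysohn _ X \<longleftrightarrow>
     (\<forall>Y :: 'b topology. strongly_frechet_urysohn Y \<longrightarrow> frechet_urysohn (prod_topology X Y))"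

section \<open>The covering property \<open>\<gamma>\<close>\<close>

definition open_cover :: "'a topology \<Rightarrow> 'a set set \<Rightarrow> bool" where
  "open_cover X \<U> \<longleftrightarrow> (\<forall>U\<in>\<U>. openin X U) \<and> \<Union>\<U> = topspace X \<and> topspace X \<notin> \<U>"

definition open_omega_cover :: "'a topology \<Rightarrow> 'a set set \<Rightarrow> bool" where
  "open_omega_cover X \<U> \<longleftrightarrow>
     open_cover X \<U> \<and> (\<forall>F. finite F \<and> F \<subseteq> topspace X \<longrightarrow> (\<exists>U\<in>\<U>. F \<subseteq> U))"

definition open_gamma_cover :: "'a topology \<Rightarrow> 'a set set \<Rightarrow> bool" where
  "open_gamma_cover X \<U> \<longleftrightarrow>
     open_cover X \<U> \<and> infinite \<U> \<and> (\<forall>p\<in>topspace X. finite {U \<in> \<U>. p \<notin> U})"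

definition gamma_space :: "'a topology \<Rightarrow> bool" where
  "gamma_space X \<longleftrightarrow>
     (\<forall>\<U>. open_omega_cover X \<U> \<longrightarrow> (\<exists>\<V>\<subseteq>\<U>. open_gamma_cover X \<V>))"

definition productively_gamma :: "'b itself \<Rightarrow> 'a topology \<Rightarrow> bool" where
  "productively_gamma _ X \<longleftrightarrow>
     (\<forall>Y :: 'b topology. gamma_space Y \<longrightarrow> gamma_space (prod_topology X Y))"

end

(* For finite F, a sequence chosen from approximations that are good on F and on Pow {..<n} is,
   by continuity, also good on every z missing some gap {n..<h n}. Unboundedness gives an index
   \<phi> F such that x (\<phi> F) misses infinitely many of these gaps, and a closing-off argument gives
   a < \<aleph>\<^sub>1 such that \<phi> F < a for every finite set F of indices below a. Now x a, and hence every
   later x b, almost misses infinitely many gaps of each of these sequences, so diagonalising over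
   the countably many F below a gives one sequence that is good on all of T \<union> Fin. The second
   factor Y enters only through its selection principle: strong Frechet--Urysohn at a point, or
   the Gerlits--Nagy characterisation of \<gamma>-spaces. *)

theory Submission
  imports Defs
begin

section \<open>Closing off in well-orders, and the order \<open>aleph1\<close>\<close>

text \<open>Closing the empty set under \<open>\<phi>\<close> and under passing to smaller elements
  takes countably many countable steps. The result is a countable, hence proper, initial segment,
  and \<open>a\<close> is the least element outside it.\<close>

lemma closed_initial_segment:
  fixes r :: "'i rel" and \<phi> :: "'i set \<Rightarrow> 'i"
  assumes wo: "Well_order r" and unc: "uncountable (Field r)"
    and cu: "\<And>a. countable (under r a)"
    and \<phi>: "\<And>F. finite F \<Longrightarrow> F \<subseteq> Field r \<Longrightarrow> \<phi> F \<in> Field r"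
  obtains a where "a \<in> Field r" "countable (underS r a)"
    "\<And>F. finite F \<Longrightarrow> F \<subseteq> underS r a \<Longrightarrow> \<phi> F \<in> underS r a"
proof -
  have "trans r" "Total r" "Refl r" "wf (r - Id)"
    using wo by (auto simp: well_order_on_def linear_order_on_def partial_order_on_def
        preorder_on_def)
  \<comment> \<open>Adding all of \<open>under r (\<phi> F)\<close>, not just
    \<open>\<phi> F\<close>, keeps every stage downward closed.\<close>
  define step where "step C = C \<union> (\<Union>F\<in>{F. finite F \<and> F \<subseteq> C}. under r (\<phi> F))" for C
  define Cn where "Cn n = (step ^^ n) {}" for n
  define C where "C = (\<Union>n. Cn n)"
  have Cn_Suc: "Cn (Suc n) = step (Cn n)" for n by (simp add: Cn_def)
  have Cn_mono: "incseq Cn"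
    by (intro incseq_SucI) (auto simp: Cn_Suc step_def)
  have "countable (Cn n)" for n
  proof (induction n)
    case (Suc n)
    then show ?case
      unfolding Cn_Suc step_def
      by (intro countable_Un countable_UN countable_Collect_finite_subset cu) auto
  qed (simp add: Cn_def)
  then have count: "countable C" by (auto simp: C_def)
  have down: "b' \<in> C" if "b \<in> C" "(b', b) \<in> r" for b b'
  proof -
    obtain n where "b \<in> Cn n" using \<open>b \<in> C\<close> by (auto simp: C_def)
    then have "b' \<in> Cn n"
    proof (induction n)
      case (Suc n)
      then show ?case
        using \<open>(b', b) \<in> r\<close> \<open>trans r\<close> unfolding Cn_Suc step_def under_def
        by (auto dest: transD)
    qed (simp add: Cn_def)
    then show ?thesis by (auto simp: C_def)
  qed
  have CF: "C \<subseteq> Field r"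
  proof -
    have "Cn n \<subseteq> Field r" for n
      by (induction n) (auto simp: Cn_def step_def under_def Field_def)
    then show ?thesis by (auto simp: C_def)
  qed
  have closed: "\<phi> F \<in> C" if "finite F" "F \<subseteq> C" for F
  proof -
    \<comment> \<open>A finite subset of the increasing union already lies in one stage, so the next
      stage contains its value under \<open>\<phi>\<close>.\<close>
    have "\<exists>n. F \<subseteq> Cn n" using that
    proof (induction F rule: finite_induct)
      case (insert y F)
      then obtain n m where "F \<subseteq> Cn n" "y \<in> Cn m" by (auto simp: C_def)
      then have "insert y F \<subseteq> Cn (max n m)"
        using incseqD[OF Cn_mono, of n "max n m"] incseqD[OF Cn_mono, of m "max n m"] by auto
      then show ?case by blast
    qed simp
    then obtain n where "F \<subseteq> Cn n" ..
    moreover have "\<phi> F \<in> under r (\<phi> F)"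
      using \<open>Refl r\<close> \<phi>[of F] that CF by (auto simp: under_def refl_on_def)
    ultimately have "\<phi> F \<in> Cn (Suc n)"
      using \<open>finite F\<close> by (auto simp: Cn_Suc step_def)
    then show ?thesis by (auto simp: C_def)
  qed
  have "\<not> Field r \<subseteq> C" using countable_subset[OF _ count] unc by auto
  then obtain c where "c \<in> Field r - C" by blast
  then obtain a where a: "a \<in> Field r - C" and min: "\<And>y. (y, a) \<in> r - Id \<Longrightarrow> y \<notin> Field r - C"
    using wfE_min[OF \<open>wf (r - Id)\<close>, of c "Field r - C"] by metis
  have "C = underS r a"
  proof (intro equalityI subsetI)
    fix b assume "b \<in> C"
    then have "b \<noteq> a" "(a, b) \<notin> r" "b \<in> Field r" using a down[of b a] CF by auto
    then show "b \<in> underS r a"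
      using a \<open>Total r\<close> by (auto simp: underS_def total_on_def)
  next
    fix b assume "b \<in> underS r a"
    then show "b \<in> C" using min[of b] by (auto simp: underS_def Field_def)
  qed
  with a count closed show ?thesis by (intro that[of a]) auto
qed

lemma countable_iff_ordLeq_natLeq:
  includes cardinal_syntax
  shows "countable A \<longleftrightarrow> |A| \<le>o natLeq"
proof -
  have "countable A \<longleftrightarrow> |A| \<le>o |UNIV :: nat set|"
    unfolding countable_def card_of_ordLeq[symmetric] by simp
  also have "\<dots> \<longleftrightarrow> |A| \<le>o natLeq"
    using card_of_nat ordLeq_ordIso_trans ordIso_symmetric by blast
  finally show ?thesis .
qed

text \<open>These are the order-theoretic inputs to the closing-off argument. A cardinal successor
  lies strictly above \<open>natLeq\<close>, while each of its strict initial segments has smaller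
  cardinality, hence at most that of \<open>natLeq\<close>.\<close>

lemma
  includes cardinal_syntax
  shows Well_order_aleph1: "Well_order aleph1"
    and uncountable_Field_aleph1: "uncountable (Field aleph1)"
    and countable_under_aleph1: "countable (under aleph1 a)"
proof -
  have co: "Card_order aleph1"
    unfolding aleph1_def by (intro cardSuc_Card_order natLeq_Card_order)
  then show wo: "Well_order aleph1" by (auto simp: card_order_on_def)
  have lt: "natLeq <o aleph1"
    unfolding aleph1_def by (intro cardSuc_greater natLeq_Card_order)
  show "uncountable (Field aleph1)"
  proof
    assume "countable (Field aleph1)"
    then have "|Field aleph1| \<le>o natLeq"
      using countable_iff_ordLeq_natLeq by blast
    then have "aleph1 \<le>o natLeq"
      using card_of_Field_ordIso[OF co] ordIso_ordLeq_trans ordIso_symmetric by blast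
    with lt show False using not_ordLess_ordLeq by blast
  qed
  have S: "countable (underS aleph1 a)" if "a \<in> Field aleph1" for a
  proof -
    have "|underS aleph1 a| <o cardSuc natLeq"
      using card_of_underS[OF co that] by (simp add: aleph1_def)
    then have "|underS aleph1 a| \<le>o natLeq"
      using cardSuc_ordLeq_ordLess[OF natLeq_Card_order card_of_Card_order] by blast
    then show ?thesis using countable_iff_ordLeq_natLeq by blast
  qed
  have "under aleph1 a \<subseteq> insert a (underS aleph1 a)"
    by (auto simp: under_def underS_def)
  moreover have "under aleph1 a = {}" if "a \<notin> Field aleph1"
    using that by (auto simp: under_def Field_def)
  ultimately show "countable (under aleph1 a)"
    using S[of a] by (metis countable_empty countable_insert countable_subset)
qed

section \<open>Unboundedness and interval gaps\<close>

text \<open>The intervals are consecutive, so each one from the \<open>k\<close>-th on contributes a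
  further element of \<open>A\<close>.\<close>

lemma enumerate_less_of_meets_intervals:
  fixes A :: "nat set" and a :: "nat \<Rightarrow> nat"
  assumes inf: "infinite A" and meet: "\<And>i. i \<ge> k \<Longrightarrow> A \<inter> {a i..<a (Suc i)} \<noteq> {}"
  shows "enumerate A n < a (Suc (k + n))"
proof (induction n)
  case 0
  obtain z where "z \<in> A" "z < a (Suc k)" using meet[of k] by auto
  then show ?case by (simp add: enumerate_0) (meson Least_le le_less_trans)
next
  case (Suc n)
  obtain z where z: "z \<in> A" "a (Suc (k + n)) \<le> z" "z < a (Suc (k + Suc n))"
    using meet[of "Suc (k + n)"] by auto
  then have "enumerate A n < z" using Suc by simp
  then have "enumerate A (Suc n) \<le> z"
    unfolding enumerate_Suc''[OF inf] using z by (intro Least_le) auto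
  with z show ?case by simp
qed

text \<open>If every member of \<open>S\<close> met almost all intervals \<open>{n..<h n}\<close>,
  iterating \<open>h\<close> would give an interval partition almost all of whose pieces it meets,
  and hence one function dominating all enumerations.\<close>

lemma unbounded_sets_gaps:
  fixes h :: "nat \<Rightarrow> nat"
  assumes unb: "unbounded_sets S" and inf: "\<And>A. A \<in> S \<Longrightarrow> infinite A"
  obtains A where "A \<in> S" "infinite {n. A \<inter> {n..<h n} = {}}"
proof -
  have False if fin: "\<And>A. A \<in> S \<Longrightarrow> finite {n. A \<inter> {n..<h n} = {}}"
  proof -
    \<comment> \<open>\<open>H n\<close> exceeds both \<open>n\<close> and \<open>h n\<close>: the
      orbit \<open>a\<close> is strictly increasing, and \<open>{a i..<a (Suc i)}\<close> contains
      \<open>{a i..<h (a i)}\<close>.\<close>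
    define H where "H n = Suc n + h n" for n
    define a where "a i = (H ^^ i) 0" for i
    have a_Suc: "a (Suc i) = H (a i)" for i by (simp add: a_def)
    have smono: "strict_mono a"
      by (rule strict_mono_Suc_iff[THEN iffD2]) (simp add: a_Suc H_def)
    \<comment> \<open>The starting index \<open>k\<close> depends on \<open>A\<close>, but the bound
      must not; \<open>2 * n\<close> absorbs the shift, as \<open>Suc (k + n) \<le> 2 * n\<close>
      once \<open>n \<ge> Suc k\<close>.\<close>
    have "enumerate A \<le>* (\<lambda>n. a (2 * n))" if "A \<in> S" for A
    proof -
      obtain k where k: "\<And>n. A \<inter> {n..<h n} = {} \<Longrightarrow> n < k"
        using fin[OF \<open>A \<in> S\<close>] by (auto simp: finite_nat_set_iff_bounded)
      have "A \<inter> {a i..<a (Suc i)} \<noteq> {}" if "i \<ge> k" for i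
      proof -
        have "a i \<ge> k" using strict_mono_imp_increasing[OF smono, of i] that by linarith
        then have "A \<inter> {a i..<h (a i)} \<noteq> {}" using k[of "a i"] by linarith
        then show ?thesis by (auto simp: a_Suc H_def)
      qed
      then have en: "enumerate A n < a (Suc (k + n))" for n
        by (intro enumerate_less_of_meets_intervals inf that)
      have "enumerate A n \<le> a (2 * n)" if "n \<ge> Suc k" for n
      proof -
        have "a (Suc (k + n)) \<le> a (2 * n)"
          using that by (intro strict_mono_leD[OF smono]) simp
        then show ?thesis using en[of n] by simp
      qed
      then show ?thesis
        unfolding eventually_dominated_def eventually_sequentially by blast
    qed
    with unb show False unfolding unbounded_sets_def by blast
  qed
  with that show ?thesis by blast
qed

section \<open>Diagonal selection along the tower\<close>

text \<open>\<open>Big\<close> and \<open>Conv\<close> abstract the second factor \<open>Y\<close>, and \<open>G e n\<close> is the set of points on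
  which the approximation \<open>e\<close> is good to precision \<open>n\<close>. For function spaces \<open>e = (g, y)\<close>, \<open>Big\<close>
  says that the given point of \<open>Y\<close> is in the closure of the second components, and \<open>Conv\<close> that
  they converge to it; for covers \<open>e\<close> is an open rectangle \<open>(K, V)\<close>, \<open>Big\<close> says that the \<open>V\<close>
  form an \<open>\<omega>\<close>-cover, and \<open>Conv\<close> that each point is in almost all \<open>V\<close>.\<close>

lemma tower_selection:
  fixes r :: "'i rel" and x :: "'i \<Rightarrow> nat set" and Big :: "'e set \<Rightarrow> bool"
    and Conv :: "(nat \<Rightarrow> 'e) \<Rightarrow> bool" and G :: "'e \<Rightarrow> nat \<Rightarrow> nat set set"
  assumes wo: "Well_order r" and unc: "uncountable (Field r)"
    and cu: "\<And>a. countable (under r a)"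
    and tow: "tower r x" and unb: "unbounded_sets (x ` Field r)"
    and Big_mono: "\<And>A B. Big A \<Longrightarrow> A \<subseteq> B \<Longrightarrow> B \<subseteq> E \<Longrightarrow> Big B"
    and select: "\<And>A. decseq A \<Longrightarrow> (\<And>n. A n \<subseteq> E) \<Longrightarrow> (\<And>n. Big (A n)) \<Longrightarrow>
        \<exists>s. (\<forall>n. s n \<in> A n) \<and> Conv s"
    and Conv_Big: "\<And>s D. (\<And>n. s n \<in> E) \<Longrightarrow> Conv s \<Longrightarrow> infinite D \<Longrightarrow> Big (s ` D)"
    and G_anti: "\<And>e. decseq (G e)"
    and large: "\<And>F n. finite F \<Longrightarrow> F \<subseteq> x ` Field r \<union> Fin \<Longrightarrow>
        Big {e \<in> E. F \<subseteq> G e n \<and>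
          (\<exists>m. \<forall>z\<in>x ` Field r \<union> Fin. z \<inter> {n..<m} = {} \<longrightarrow> z \<in> G e n)}"
  obtains s where "\<And>j. s j \<in> E" "Conv s"
    "\<And>z. z \<in> x ` Field r \<union> Fin \<Longrightarrow> \<forall>\<^sub>F j in sequentially. z \<in> G (s j) j"
proof -
  let ?X = "x ` Field r \<union> Fin"
  define near where "near e n m \<longleftrightarrow> (\<forall>z\<in>?X. z \<inter> {n..<m} = {} \<longrightarrow> z \<in> G e n)" for e n m
  define near where "near e n m \<longleftrightarrow> (\<forall>z\<in>?X. z \<inter> {n..<m} = {} \<longrightarrow> z \<in> G e n)" for e n m
  define A where "A F n = {e \<in> E. x ` F \<subseteq> G e n \<and> (\<exists>m. near e n m)}" for F n
  define ok where "ok F s h b \<longleftrightarrow> (\<forall>n. s n \<in> E \<and> x ` F \<subseteq> G (s n) n \<and> near (s n) n (h n)) \<and>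
      Conv s \<and> b \<in> Field r \<and> infinite {n. x b \<inter> {n..<h n} = {}}" for F s h b
  have "\<exists>s h b. ok F s h b" if F: "finite F" "F \<subseteq> Field r" for F
  proof -
    \<comment> \<open>The same \<open>m\<close> serves at the lower precision: avoiding
      \<open>{n..<m}\<close> implies avoiding \<open>{Suc n..<m}\<close>.\<close>
    have "A F (Suc n) \<subseteq> A F n" for n
    proof
      fix e assume e: "e \<in> A F (Suc n)"
      have sub: "G e (Suc n) \<subseteq> G e n" using decseqD[OF G_anti] by simp
      from e obtain m where m: "near e (Suc n) m" by (auto simp: A_def)
      have "z \<in> G e n" if "z \<in> ?X" "z \<inter> {n..<m} = {}" for z
      proof -
        have "{Suc n..<m} \<subseteq> {n..<m}" by auto
        with that(2) have "z \<inter> {Suc n..<m} = {}" by blast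
        then have "z \<in> G e (Suc n)" using m that(1) unfolding near_def by blast
        then show ?thesis using sub by blast
      qed
      then have "near e n m" unfolding near_def by blast
      moreover have "e \<in> E" "x ` F \<subseteq> G e n" using e sub by (auto simp: A_def)
      ultimately show "e \<in> A F n" by (auto simp: A_def)
    qed
    then have "decseq (A F)" by (intro decseq_SucI)
    moreover have "Big (A F n)" for n
      unfolding A_def near_def using F by (intro large) auto
    moreover have "A F n \<subseteq> E" for n by (auto simp: A_def)
    ultimately obtain s where s: "\<And>n. s n \<in> A F n" "Conv s"
      using select[of "A F"] by blast
    then have "\<forall>n. \<exists>m. near (s n) n m" by (auto simp: A_def)
    then obtain h where h: "\<And>n. near (s n) n (h n)" by metis
    have "infinite z" if "z \<in> x ` Field r" for z using that tow by (auto simp: tower_def)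
    then obtain b where "b \<in> Field r" "infinite {n. x b \<inter> {n..<h n} = {}}"
      using unbounded_sets_gaps[OF unb, of h] by blast
    moreover have "s n \<in> E" "x ` F \<subseteq> G (s n) n" for n using s(1)[of n] by (auto simp: A_def)
    ultimately have "ok F s h b" using s h unfolding ok_def by blast
    then show ?thesis by blast
  qed
  then obtain s h \<phi> where ok: "\<And>F. finite F \<Longrightarrow> F \<subseteq> Field r \<Longrightarrow> ok F (s F) (h F) (\<phi> F)"
    by metis
  have sE: "s F n \<in> E" and sF: "x ` F \<subseteq> G (s F n) n" and sC: "Conv (s F)"
    and \<phi>F: "\<phi> F \<in> Field r" and \<phi>inf: "infinite {n. x (\<phi> F) \<inter> {n..<h F n} = {}}"
    and sh: "z \<in> ?X \<Longrightarrow> z \<inter> {n..<h F n} = {} \<Longrightarrow> z \<in> G (s F n) n"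
    if "finite F" "F \<subseteq> Field r" for F n z
    using ok[OF that] by (auto simp: ok_def near_def)
  obtain a where a: "a \<in> Field r" "countable (underS r a)"
    and closed: "\<And>F. finite F \<Longrightarrow> F \<subseteq> underS r a \<Longrightarrow> \<phi> F \<in> underS r a"
    using closed_initial_segment[OF wo unc cu, of \<phi>] \<phi>F by metis
  define C where "C = underS r a"
  \<comment> \<open>\<open>\<phi> {}\<close> lies below \<open>a\<close>, so
    \<open>from_nat_into C\<close> enumerates \<open>C\<close>, and the sets \<open>F k\<close>
    below increase to \<open>C\<close>.\<close>
  have "C \<noteq> {}" using closed[of "{}"] by (auto simp: C_def)
  have CF: "C \<subseteq> Field r" by (auto simp: C_def underS_def Field_def)
  define F where "F k = from_nat_into C ` {..k}" for k
  have F: "finite (F k)" "F k \<subseteq> C" "F k \<subseteq> Field r" for k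
    using from_nat_into[OF \<open>C \<noteq> {}\<close>] CF by (auto simp: F_def)
  \<comment> \<open>The gaps of the \<open>k\<close>-th sequence that \<open>x a\<close> itself
    misses. The clause \<open>k \<le> n\<close> forces the indices selected later to tend to
    infinity.\<close>
  define D where "D k = {n. k \<le> n \<and> x a \<inter> {n..<h (F k) n} = {}}" for k
  have Dinf: "infinite (D k)" for k
  proof -
    \<comment> \<open>Since \<open>\<phi> (F k)\<close> precedes \<open>a\<close>, the tower gives
      \<open>x a \<subseteq>* x (\<phi> (F k))\<close>; beyond the finite exception, gaps missed by
      the larger set are missed by \<open>x a\<close>.\<close>
    have "(\<phi> (F k), a) \<in> r" "\<phi> (F k) \<noteq> a"
      using closed[of "F k"] F by (auto simp: underS_def C_def)
    then have "finite (x a - x (\<phi> (F k)))"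
      using tow by (auto simp: tower_def almost_subset_def)
    then obtain N where N: "\<And>i. i \<in> x a \<Longrightarrow> i \<notin> x (\<phi> (F k)) \<Longrightarrow> i < N"
      by (auto simp: finite_nat_set_iff_bounded)
    have "{n. x (\<phi> (F k)) \<inter> {n..<h (F k) n} = {}} - {..<max k N} \<subseteq> D k"
    proof
      fix n assume n: "n \<in> {n. x (\<phi> (F k)) \<inter> {n..<h (F k) n} = {}} - {..<max k N}"
      have "i \<notin> x a" if "i \<in> {n..<h (F k) n}" for i
        using N[of i] n that by force
      then show "n \<in> D k" using n by (auto simp: D_def)
    qed
    moreover have "infinite ({n. x (\<phi> (F k)) \<inter> {n..<h (F k) n} = {}} - {..<max k N})"
      using \<phi>inf[OF F(1,3)] by (intro Diff_infinite_finite) auto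
    ultimately show ?thesis using infinite_super by blast
  qed
  \<comment> \<open>Each tail union contains a subsequence of a convergent sequence, so it is
    \<open>Big\<close>. A second selection from these decreasing sets then diagonalises over all
    \<open>F k\<close>, with \<open>j \<le> k j \<le> n j\<close>.\<close>
  define B where "B j = (\<Union>k\<in>{j..}. s (F k) ` D k)" for j
  have BE: "B j \<subseteq> E" for j using sE[OF F(1,3)] by (auto simp: B_def)
  have "Big (B j)" for j
  proof (rule Big_mono[OF _ _ BE])
    show "Big (s (F j) ` D j)"
      by (intro Conv_Big sC sE F Dinf)
  qed (auto simp: B_def)
  moreover have "decseq B" unfolding decseq_def B_def by (intro allI impI UN_mono) auto
  ultimately obtain e where e: "\<And>j. e j \<in> B j" "Conv e"
    using select[of B] BE by metis
  have "\<forall>j. \<exists>k n. j \<le> k \<and> n \<in> D k \<and> e j = s (F k) n"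
    using e(1) by (fastforce simp: B_def)
  then obtain k n where kn: "\<And>j. j \<le> k j" "\<And>j. n j \<in> D (k j)" "\<And>j. e j = s (F (k j)) (n j)"
    by metis
  have jn: "j \<le> n j" for j using kn(1,2)[of j] by (auto simp: D_def)
  have G_j: "z \<in> G (e j) j" if "z \<in> G (s (F (k j)) (n j)) (n j)" for z j
    using that decseqD[OF G_anti jn] kn(3) by auto
  have avoid: "z \<in> G (e j) j" if "z \<in> ?X" "z \<inter> {n j..<h (F (k j)) (n j)} = {}" for z j
    by (intro G_j sh F that)
  show thesis
  proof (rule that)
    show "e j \<in> E" for j using e(1) BE by blast
    fix z assume z: "z \<in> ?X"
    \<comment> \<open>A finite \<open>z\<close> eventually lies below the gaps. If
      \<open>z = x b\<close> with \<open>b\<close> in \<open>C\<close>, then \<open>b\<close>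
      eventually belongs to \<open>F (k j)\<close>. Otherwise \<open>b\<close> is \<open>a\<close>
      or later, so \<open>z \<subseteq>* x a\<close>, and \<open>x a\<close> misses every gap
      used.\<close>
    then consider "finite z" | b where "b \<in> Field r" "z = x b" by (auto simp: Fin_def)
    then have "\<exists>N. \<forall>j\<ge>N. z \<in> G (e j) j"
    proof cases
      case 1
      then obtain N where N: "z \<subseteq> {..<N}" using finite_nat_iff_bounded by blast
      have "z \<inter> {n j..<h (F (k j)) (n j)} = {}" if "j \<ge> N" for j
        using N jn[of j] that by force
      then show ?thesis using avoid[OF z] by blast
    next
      case 2
      show ?thesis
      proof (cases "b \<in> C")
        case True
        then obtain i where "b = from_nat_into C i"
          using from_nat_into_surj a(2) C_def by metis
        then have "b \<in> F (k j)" if "j \<ge> i" for j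
          using that kn(1)[of j] by (auto simp: F_def)
        then show ?thesis using 2 sF[OF F(1,3)] G_j by blast
      next
        case False
        then have "b = a \<or> (a, b) \<in> r \<and> a \<noteq> b"
          using wo a(1) 2(1)
          by (auto simp: C_def underS_def well_order_on_def linear_order_on_def total_on_def)
        then have "finite (z - x a)"
          using tow 2(2) by (auto simp: tower_def almost_subset_def)
        then obtain N where N: "\<And>i. i \<in> z \<Longrightarrow> i \<notin> x a \<Longrightarrow> i < N"
          by (auto simp: finite_nat_set_iff_bounded)
        have "z \<inter> {n j..<h (F (k j)) (n j)} = {}" if "j \<ge> N" for j
        proof -
          have "x a \<inter> {n j..<h (F (k j)) (n j)} = {}" using kn(2)[of j] by (auto simp: D_def)
          moreover have "i \<in> x a" if "i \<in> z" "n j \<le> i" for i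
            using N[of i] that jn[of j] \<open>j \<ge> N\<close> by force
          ultimately show ?thesis by force
        qed
        then show ?thesis using avoid[OF z] by blast
      qed
    qed
    then show "\<forall>\<^sub>F j in sequentially. z \<in> G (e j) j"
      by (simp add: eventually_sequentially)
  qed (use e in auto)
qed

section \<open>Neighbourhoods in the Cantor space\<close>

lemma topspace_cantor [simp]: "topspace cantor_topology = UNIV"
  unfolding cantor_topology_def topspace_pullback_topology by auto

lemma Pow_lessThan_subset_Fin: "Pow {..<n} \<subseteq> Fin"
  by (auto simp: Fin_def intro: finite_subset)

lemma openin_cantor_basic:
  assumes "openin cantor_topology U" "z \<in> U"
  obtains m where "\<And>w. w \<inter> {..<m} = z \<inter> {..<m} \<Longrightarrow> w \<in> U"
proof -
  obtain S where S: "openin (product_topology (\<lambda>_. discrete_topology (UNIV :: bool set)) UNIV) S"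
    and U: "U = (\<lambda>A n. n \<in> A) -` S"
    using assms(1) by (auto simp: cantor_topology_def openin_pullback_topology)
  have "(\<lambda>n::nat. n \<in> z) \<in> S" using assms(2) U by auto
  then obtain V :: "nat \<Rightarrow> bool set" where V: "finite {i. V i \<noteq> UNIV}"
    "(\<lambda>n. n \<in> z) \<in> Pi\<^sub>E UNIV V" "Pi\<^sub>E UNIV V \<subseteq> S"
    using S unfolding openin_product_topology_alt by fastforce
  obtain m where m: "\<And>i. V i \<noteq> UNIV \<Longrightarrow> i < m"
    using V(1) by (auto simp: finite_nat_set_iff_bounded)
  show thesis
  proof (rule that[of m])
    fix w assume w: "w \<inter> {..<m} = z \<inter> {..<m}"
    have "(i \<in> w) \<in> V i" for i
    proof (cases "V i = UNIV")
      case False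
      then have "i \<in> w \<longleftrightarrow> i \<in> z" using w m by blast
      moreover have "(i \<in> z) \<in> V i" using V(2) by (auto simp: PiE_iff)
      ultimately show ?thesis by simp
    qed simp
    then have "(\<lambda>n. n \<in> w) \<in> Pi\<^sub>E UNIV V" by (auto simp: PiE_iff)
    then show "w \<in> U" using V(3) U by auto
  qed
qed

text \<open>Each of the finitely many subsets of \<open>{..<n}\<close> has a basic neighbourhood
  inside the open set. With \<open>m\<close> bounding all their lengths, a set missing
  \<open>{n..<m}\<close> agrees below \<open>m\<close> with its own trace on
  \<open>{..<n}\<close>.\<close>

lemma openin_cantor_gap:
  assumes U: "openin (subtopology cantor_topology S) U" and sub: "Pow {..<n} \<subseteq> U"
  shows "\<exists>m. \<forall>z\<in>S. z \<inter> {n..<m} = {} \<longrightarrow> z \<in> U"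
proof -
  obtain W where W: "openin cantor_topology W" "U = W \<inter> S"
    using U by (auto simp: openin_subtopology)
  have "\<exists>m. \<forall>w. w \<inter> {..<m} = s \<inter> {..<m} \<longrightarrow> w \<in> W" if "s \<in> Pow {..<n}" for s
  proof -
    have "s \<in> W" using that sub W(2) by blast
    then obtain m where "\<And>w. w \<inter> {..<m} = s \<inter> {..<m} \<Longrightarrow> w \<in> W"
      using openin_cantor_basic[OF W(1)] by metis
    then show ?thesis by blast
  qed
  then obtain M where M: "\<And>s w. s \<in> Pow {..<n} \<Longrightarrow> w \<inter> {..<M s} = s \<inter> {..<M s} \<Longrightarrow> w \<in> W"
    by metis
  define m where "m = Max (M ` Pow {..<n})"
  have "z \<in> U" if z: "z \<in> S" "z \<inter> {n..<m} = {}" for z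
  proof -
    let ?s = "z \<inter> {..<n}"
    have "M ?s \<le> m" unfolding m_def by (intro Max_ge) auto
    have "i < n" if "i \<in> z" "i < M ?s" for i
    proof (rule ccontr)
      assume "\<not> i < n"
      then have "i \<in> z \<inter> {n..<m}" using that \<open>M ?s \<le> m\<close> by auto
      with z show False by blast
    qed
    then have "z \<inter> {..<M ?s} = ?s \<inter> {..<M ?s}" by blast
    then have "z \<in> W" by (intro M[of ?s]) auto
    then show ?thesis using W z by blast
  qed
  then show ?thesis by blast
qed

section \<open>Gamma-spaces via sequences and selection\<close>

lemma open_omega_cover_iff:
  "open_omega_cover X \<U> \<longleftrightarrow> (\<forall>U\<in>\<U>. openin X U) \<and> topspace X \<notin> \<U> \<and>
     (\<forall>F. finite F \<and> F \<subseteq> topspace X \<longrightarrow> (\<exists>U\<in>\<U>. F \<subseteq> U))"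
  (is "?L \<longleftrightarrow> ?R")
proof
  assume ?L
  then show ?R by (simp add: open_omega_cover_def open_cover_def)
next
  assume R: ?R
  have "\<Union>\<U> = topspace X"
  proof
    show "\<Union>\<U> \<subseteq> topspace X" using R by (intro Union_least openin_subset) simp
    show "topspace X \<subseteq> \<Union>\<U>"
    proof
      fix p assume "p \<in> topspace X"
      moreover have "finite {p} \<and> {p} \<subseteq> topspace X \<longrightarrow> (\<exists>U\<in>\<U>. {p} \<subseteq> U)"
        using R by metis
      ultimately show "p \<in> \<Union>\<U>" by auto
    qed
  qed
  with R show ?L by (simp add: open_omega_cover_def open_cover_def)
qed

text \<open>An injective sequence drawn from an infinite \<gamma>-cover suffices: injectivity turns
  finitely many bad members into finitely many bad indices.\<close>

lemma gamma_space_sequence: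
  assumes "gamma_space X" "open_omega_cover X \<U>"
  obtains U :: "nat \<Rightarrow> 'a set" where "\<And>n. U n \<in> \<U>"
    "\<And>p. p \<in> topspace X \<Longrightarrow> \<forall>\<^sub>F n in sequentially. p \<in> U n"
proof -
  obtain \<V> where \<V>: "\<V> \<subseteq> \<U>" "open_gamma_cover X \<V>"
    using assms unfolding gamma_space_def by blast
  then have "infinite \<V>" by (simp add: open_gamma_cover_def)
  then obtain U :: "nat \<Rightarrow> 'a set" where U: "inj U" "range U \<subseteq> \<V>"
    using infinite_countable_subset by blast
  show thesis
  proof (rule that)
    show "U n \<in> \<U>" for n using U \<V> by blast
    fix p assume "p \<in> topspace X"
    then have "finite {V \<in> \<V>. p \<notin> V}" using \<V> by (simp add: open_gamma_cover_def)
    then have "finite (U -` {V \<in> \<V>. p \<notin> V})" using U(1) by (intro finite_vimageI)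
    moreover have "U -` {V \<in> \<V>. p \<notin> V} = {n. p \<notin> U n}" using U(2) by auto
    ultimately have "\<forall>\<^sub>F n in cofinite. p \<in> U n" by (simp add: eventually_cofinite)
    then show "\<forall>\<^sub>F n in sequentially. p \<in> U n" by (simp add: cofinite_eq_sequentially)
  qed
qed

text \<open>Repetitions in the sequence are harmless: a member occurring infinitely often would
  contain every point, which no member of the cover does, so the range is infinite.\<close>

lemma gamma_spaceI:
  assumes seq: "\<And>\<U>. open_omega_cover X \<U> \<Longrightarrow>
    \<exists>U::nat \<Rightarrow> 'a set. (\<forall>n. U n \<in> \<U>) \<and>
      (\<forall>p\<in>topspace X. \<forall>\<^sub>F n in sequentially. p \<in> U n)"
  shows "gamma_space X"
  unfolding gamma_space_def
proof (intro allI impI)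
  fix \<U> assume \<U>: "open_omega_cover X \<U>"
  then obtain U :: "nat \<Rightarrow> 'a set" where U: "\<And>n. U n \<in> \<U>"
    and ev: "\<And>p. p \<in> topspace X \<Longrightarrow> \<forall>\<^sub>F n in sequentially. p \<in> U n"
    using seq by metis
  have fin: "finite {n. p \<notin> U n}" if "p \<in> topspace X" for p
    using ev[OF that] by (simp add: cofinite_eq_sequentially[symmetric] eventually_cofinite)
  have op: "openin X (U n)" "U n \<noteq> topspace X" for n
    using \<U> U[of n] by (auto simp: open_omega_cover_iff)
  have "infinite (range U)"
  proof
    assume "finite (range U)"
    then obtain n where n: "infinite {m. U m = U n}"
      using pigeonhole_infinite[of UNIV U] by auto
    obtain p where p: "p \<in> topspace X" "p \<notin> U n"
      using op[of n] openin_subset by blast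
    have "{m. U m = U n} \<subseteq> {m. p \<notin> U m}" using p by auto
    with n fin[OF p(1)] show False using finite_subset by blast
  qed
  moreover have "finite {V \<in> range U. p \<notin> V}" if "p \<in> topspace X" for p
  proof -
    have "{V \<in> range U. p \<notin> V} = U ` {n. p \<notin> U n}" by auto
    then show ?thesis using fin[OF that] by simp
  qed
  moreover have "\<Union> (range U) = topspace X"
  proof
    show "\<Union> (range U) \<subseteq> topspace X" using op openin_subset by blast
    show "topspace X \<subseteq> \<Union> (range U)"
    proof
      fix p assume "p \<in> topspace X"
      then obtain n where "p \<in> U n" using ev eventually_happens[of _ sequentially] by fastforce
      then show "p \<in> \<Union> (range U)" by blast
    qed
  qed
  moreover have "topspace X \<notin> range U" using op(2) by (metis rangeE)
  ultimately have "open_gamma_cover X (range U)"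
    using op(1) by (simp add: open_gamma_cover_def open_cover_def)
  moreover have "range U \<subseteq> \<U>" using U by auto
  ultimately show "\<exists>\<V>\<subseteq>\<U>. open_gamma_cover X \<V>" by metis
qed

text \<open>The Gerlits--Nagy selection principle. The families may contain the whole space; one that
  does not supplies the sets \<open>P n\<close>, and since these are proper, a sequence refining
  \<open>P n \<inter> W 0 \<inter> \<dots> \<inter> W n\<close> can use each \<open>n\<close> only finitely often.\<close>

lemma gamma_space_selection:
  fixes \<V> :: "nat \<Rightarrow> 'a set set"
  assumes \<gamma>: "gamma_space Y" and op: "\<And>n V. V \<in> \<V> n \<Longrightarrow> openin Y V"
    and \<omega>: "\<And>n F. finite F \<Longrightarrow> F \<subseteq> topspace Y \<Longrightarrow> \<exists>V\<in>\<V> n. F \<subseteq> V"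
  obtains V where "\<And>n. V n \<in> \<V> n"
    "\<And>y. y \<in> topspace Y \<Longrightarrow> \<forall>\<^sub>F n in sequentially. y \<in> V n"
proof (cases "\<forall>n. topspace Y \<in> \<V> n")
  case True
  then show ?thesis by (intro that[of "\<lambda>_. topspace Y"]) auto
next
  case False
  then obtain n0 where n0: "topspace Y \<notin> \<V> n0" by blast
  have "open_omega_cover Y (\<V> n0)"
    using op \<omega> n0 by (auto simp: open_omega_cover_iff)
  from gamma_space_sequence[OF \<gamma> this] obtain P :: "nat \<Rightarrow> 'a set" where P: "\<And>n. P n \<in> \<V> n0"
    and Pev: "\<And>y. y \<in> topspace Y \<Longrightarrow> \<forall>\<^sub>F n in sequentially. y \<in> P n" by metis
  \<comment> \<open>A single member of the combined cover records choices from the families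
    \<open>0\<close> to \<open>n\<close>; the factor \<open>P n\<close> limits how often a given
    \<open>n\<close> can recur.\<close>
  define Q where "Q n W = P n \<inter> (\<Inter>i\<le>n. W i)" for n and W :: "nat \<Rightarrow> 'a set"
  define \<Q> where "\<Q> = {Q n W |n W. \<forall>i. W i \<in> \<V> i}"
  have "openin Y (Q n W)" if "\<forall>i. W i \<in> \<V> i" for n W
    unfolding Q_def using P op that by (intro openin_Int openin_INT2) auto
  moreover have proper: "\<exists>z\<in>topspace Y. z \<notin> P n" for n
  proof -
    have "P n \<subseteq> topspace Y" using op[OF P] by (rule openin_subset)
    moreover have "P n \<noteq> topspace Y" using n0 P[of n] by auto
    ultimately show ?thesis by blast
  qed
  moreover have "\<exists>U\<in>\<Q>. F \<subseteq> U" if F: "finite F" "F \<subseteq> topspace Y" for F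
  proof -
    have "\<forall>\<^sub>F n in sequentially. \<forall>y\<in>F. y \<in> P n"
      using F Pev by (intro eventually_ball_finite) auto
    then obtain n where n: "F \<subseteq> P n"
      using eventually_happens[of _ sequentially] by fastforce
    obtain W where "\<And>i. W i \<in> \<V> i" "\<And>i. F \<subseteq> W i" using \<omega>[OF F] by metis
    with n have "Q n W \<in> \<Q>" "F \<subseteq> Q n W" by (auto simp: \<Q>_def Q_def)
    then show ?thesis by blast
  qed
  moreover have "topspace Y \<notin> \<Q>" using proper by (auto simp: \<Q>_def Q_def)
  ultimately have "open_omega_cover Y \<Q>"
    by (auto simp: open_omega_cover_iff \<Q>_def)
  from gamma_space_sequence[OF \<gamma> this] obtain U :: "nat \<Rightarrow> 'a set" where U: "\<And>k. U k \<in> \<Q>"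
    and Uev: "\<And>y. y \<in> topspace Y \<Longrightarrow> \<forall>\<^sub>F k in sequentially. y \<in> U k" by metis
  have "\<forall>k. \<exists>n W. U k = Q n W \<and> (\<forall>i. W i \<in> \<V> i)" using U by (auto simp: \<Q>_def)
  then obtain n W where nW: "\<And>k. U k = Q (n k) (W k)" "\<And>k i. W k i \<in> \<V> i" by metis
  have unb: "\<exists>k\<ge>j. j \<le> n k" for j
  proof -
    \<comment> \<open>The points \<open>z i\<close> for \<open>i < j\<close> are finitely many, so
      some late \<open>U k\<close> contains them all; as \<open>U k \<subseteq> P (n k)\<close>
      omits \<open>z (n k)\<close>, this rules out \<open>n k < j\<close>.\<close>
    obtain z where z: "\<And>i. z i \<in> topspace Y" "\<And>i. z i \<notin> P i" using proper by metis
    have "\<forall>\<^sub>F k in sequentially. \<forall>i\<in>{..<j}. z i \<in> U k"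
      using z Uev by (intro eventually_ball_finite) auto
    then obtain k0 where k0: "\<And>k i. k \<ge> k0 \<Longrightarrow> i < j \<Longrightarrow> z i \<in> U k"
      by (auto simp: eventually_sequentially)
    have "j \<le> n (max j k0)"
    proof (rule ccontr)
      assume "\<not> j \<le> n (max j k0)"
      then have "z (n (max j k0)) \<in> U (max j k0)" by (intro k0) auto
      with z(2) nW(1) show False by (auto simp: Q_def)
    qed
    then show ?thesis by (intro exI[of _ "max j k0"]) auto
  qed
  then obtain \<kappa> where \<kappa>: "\<And>j. j \<le> \<kappa> j" "\<And>j. j \<le> n (\<kappa> j)" by metis
  show ?thesis
  \<comment> \<open>\<open>j \<le> n (\<kappa> j)\<close> puts \<open>W (\<kappa> j) j\<close> among
    the sets intersected in \<open>U (\<kappa> j)\<close>, and \<open>j \<le> \<kappa> j\<close>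
    carries eventual membership over.\<close>
  proof (rule that[of "\<lambda>j. W (\<kappa> j) j"])
    fix y assume "y \<in> topspace Y"
    then obtain k0 where k0: "\<And>k. k \<ge> k0 \<Longrightarrow> y \<in> U k"
      using Uev by (auto simp: eventually_sequentially)
    have "y \<in> W (\<kappa> j) j" if "j \<ge> k0" for j
      using k0[of "\<kappa> j"] \<kappa>[of j] that nW(1) by (auto simp: Q_def)
    then show "\<forall>\<^sub>F j in sequentially. y \<in> W (\<kappa> j) j" by (auto simp: eventually_sequentially)
  qed (use nW in auto)
qed

section \<open>Products with gamma-spaces\<close>

lemma productively_gamma_unbounded_tower:
  fixes x :: "nat set \<Rightarrow> nat set"
  assumes tow: "tower aleph1 x" and unb: "unbounded_sets (x ` Field aleph1)"
  shows "productively_gamma TYPE('c) (subtopology cantor_topology (x ` Field aleph1 \<union> Fin))"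
  unfolding productively_gamma_def
proof (intro allI impI)
  fix Y :: "'c topology" assume \<gamma>: "gamma_space Y"
  define X where "X = subtopology cantor_topology (x ` Field aleph1 \<union> Fin)"
  have topX: "topspace X = x ` Field aleph1 \<union> Fin" by (simp add: X_def)
  have "gamma_space (prod_topology X Y)"
  proof (rule gamma_spaceI)
    fix \<U> assume \<U>: "open_omega_cover (prod_topology X Y) \<U>"
    define E where "E = {(K, V). openin X K \<and> openin Y V \<and> (\<exists>U\<in>\<U>. K \<times> V \<subseteq> U)}"
    define Big where "Big B \<longleftrightarrow> (\<forall>F. finite F \<and> F \<subseteq> topspace Y \<longrightarrow> (\<exists>e\<in>B. F \<subseteq> snd e))"
      for B :: "(nat set set \<times> 'c set) set"
    define Conv where "Conv s \<longleftrightarrow> (\<forall>y\<in>topspace Y. \<forall>\<^sub>F n in sequentially. y \<in> snd (s n))"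
      for s :: "nat \<Rightarrow> nat set set \<times> 'c set"
    \<comment> \<open>For a rectangle, goodness is membership in its first side, so it is constant
      in the precision \<open>n\<close>; only the gap condition depends on \<open>n\<close>.\<close>
    define G where "G e n = fst e" for e :: "nat set set \<times> 'c set" and n :: nat
    obtain s where sE: "\<And>j. s j \<in> E" and sC: "Conv s"
      and sG: "\<And>z. z \<in> x ` Field aleph1 \<union> Fin \<Longrightarrow> \<forall>\<^sub>F j in sequentially. z \<in> G (s j) j"
    proof (rule tower_selection[OF Well_order_aleph1 uncountable_Field_aleph1
          countable_under_aleph1 tow unb, of Big E Conv G])
      show "Big B" if AB: "Big A" "A \<subseteq> B" "B \<subseteq> E" for A B
        unfolding Big_def
      proof (intro allI impI)
        fix F assume "finite F \<and> F \<subseteq> topspace Y"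
        then obtain e where "e \<in> A" "F \<subseteq> snd e" using AB(1) unfolding Big_def by metis
        then show "\<exists>e\<in>B. F \<subseteq> snd e" using AB(2) by auto
      qed
      show "\<exists>s. (\<forall>n. s n \<in> A n) \<and> Conv s" if A: "\<And>n. A n \<subseteq> E" "\<And>n. Big (A n)" for A
      proof -
        have "\<exists>V\<in>snd ` A n. F \<subseteq> V" if F: "finite F" "F \<subseteq> topspace Y" for n F
        proof -
          obtain e where "e \<in> A n" "F \<subseteq> snd e" using A(2)[of n] F unfolding Big_def by metis
          then show ?thesis by auto
        qed
        moreover have "openin Y V" if "V \<in> snd ` A n" for n V
          using that A(1)[of n] by (auto simp: E_def)
        ultimately obtain V where V: "\<And>n. V n \<in> snd ` A n"
          "\<And>y. y \<in> topspace Y \<Longrightarrow> \<forall>\<^sub>F n in sequentially. y \<in> V n"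
          using gamma_space_selection[OF \<gamma>, of "\<lambda>n. snd ` A n"] by metis
        have "\<forall>n. \<exists>e. e \<in> A n \<and> V n = snd e" using V(1) by blast
        then obtain s where "\<And>n. s n \<in> A n" "\<And>n. V n = snd (s n)" by metis
        with V(2) show ?thesis by (intro exI[of _ s]) (auto simp: Conv_def)
      qed
      show "Big (s ` D)" if s: "Conv s" and D: "infinite D" for s D
        unfolding Big_def
      proof (intro allI impI)
        fix F assume F: "finite F \<and> F \<subseteq> topspace Y"
        then have "\<forall>\<^sub>F n in sequentially. \<forall>y\<in>F. y \<in> snd (s n)"
          using s by (intro eventually_ball_finite) (auto simp: Conv_def)
        then obtain N where N: "\<And>n. n \<ge> N \<Longrightarrow> F \<subseteq> snd (s n)"
          unfolding eventually_sequentially by blast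
        obtain n where "n \<in> D" "n \<ge> N" using D infinite_nat_iff_unbounded_le by blast
        with N show "\<exists>e\<in>s ` D. F \<subseteq> snd e" by blast
      qed
      show "decseq (G e)" for e by (auto simp: G_def decseq_def)
      show "Big {e \<in> E. F \<subseteq> G e n \<and>
          (\<exists>m. \<forall>z\<in>x ` Field aleph1 \<union> Fin. z \<inter> {n..<m} = {} \<longrightarrow> z \<in> G e n)}"
        if F: "finite F" "F \<subseteq> x ` Field aleph1 \<union> Fin" for F n
        unfolding Big_def
      proof (intro allI impI)
        fix F' assume F': "finite F' \<and> F' \<subseteq> topspace Y"
        \<comment> \<open>Enlarging \<open>F\<close> by all subsets of \<open>{..<n}\<close> makes
          the side \<open>K\<close> found below contain \<open>Pow {..<n}\<close>, as
          \<open>openin_cantor_gap\<close> requires.\<close>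
        let ?F = "F \<union> Pow {..<n}"
        note P = Pow_lessThan_subset_Fin[of n]
        then have "finite ?F" "?F \<subseteq> topspace X" using F topX by auto
        moreover obtain U where U: "U \<in> \<U>" "?F \<times> F' \<subseteq> U"
        proof -
          have "finite (?F \<times> F')" "?F \<times> F' \<subseteq> topspace (prod_topology X Y)"
            using F F' P topX by auto
          then show thesis using \<U> that unfolding open_omega_cover_iff by metis
        qed
        moreover have "openin (prod_topology X Y) U" using \<U> U by (auto simp: open_omega_cover_iff)
        \<comment> \<open>Finite sets are compact, so Wallace's theorem fits an open rectangle
          between \<open>?F \<times> F'\<close> and \<open>U\<close>.\<close>
        ultimately obtain K V where KV: "openin X K" "openin Y V" "?F \<subseteq> K" "F' \<subseteq> V" "K \<times> V \<subseteq> U"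
          using F' Wallace_theorem_prod_topology[of X ?F Y F' U] finite_imp_compactin by metis
        moreover have "\<exists>m. \<forall>z\<in>x ` Field aleph1 \<union> Fin. z \<inter> {n..<m} = {} \<longrightarrow> z \<in> K"
          using KV by (intro openin_cantor_gap) (auto simp: X_def)
        ultimately show "\<exists>e\<in>{e \<in> E. F \<subseteq> G e n \<and>
            (\<exists>m. \<forall>z\<in>x ` Field aleph1 \<union> Fin. z \<inter> {n..<m} = {} \<longrightarrow> z \<in> G e n)}. F' \<subseteq> snd e"
          using U(1) by (intro bexI[of _ "(K, V)"]) (auto simp: E_def G_def)
      qed
    qed blast
    have "\<exists>U\<in>\<U>. fst (s j) \<times> snd (s j) \<subseteq> U" for j
      using sE[of j] by (simp add: E_def case_prod_unfold)
    then obtain U where U: "\<And>j. U j \<in> \<U>" "\<And>j. fst (s j) \<times> snd (s j) \<subseteq> U j" by metis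
    have "\<forall>\<^sub>F j in sequentially. p \<in> U j" if p: "p \<in> topspace (prod_topology X Y)" for p
    proof -
      have "\<forall>\<^sub>F j in sequentially. fst p \<in> fst (s j)" "\<forall>\<^sub>F j in sequentially. snd p \<in> snd (s j)"
        using p sG[of "fst p"] sC topX by (auto simp: Conv_def G_def)
      then show ?thesis
      proof eventually_elim
        case (elim j)
        then have "(fst p, snd p) \<in> U j" using U(2)[of j] by blast
        then show ?case by simp
      qed
    qed
    with U show "\<exists>U::nat \<Rightarrow> (nat set \<times> 'c) set. (\<forall>n. U n \<in> \<U>) \<and>
        (\<forall>p\<in>topspace (prod_topology X Y). \<forall>\<^sub>F n in sequentially. p \<in> U n)" by blast
  qed
  then show "gamma_space (prod_topology (subtopology cantor_topology (x ` Field aleph1 \<union> Fin)) Y)"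
    by (simp add: X_def)
qed

section \<open>Pointwise convergence and Frechet-Urysohn products\<close>

lemma openin_Cp_uniform_on_finite:
  assumes F: "finite F" "F \<subseteq> topspace X"
  shows "openin (Cp X) {g \<in> topspace (Cp X). \<forall>z\<in>F. \<bar>g z - f z\<bar> < \<epsilon>}"
proof -
  define S where "S z = (if z \<in> F then ball (f z) \<epsilon> else UNIV)" for z
  have "{z \<in> topspace X. S z \<noteq> topspace euclideanreal} \<subseteq> F" by (auto simp: S_def)
  then have "finite {z \<in> topspace X. S z \<noteq> topspace euclideanreal}"
    using F(1) finite_subset by blast
  then have "openin (product_topology (\<lambda>_. euclideanreal) (topspace X)) (Pi\<^sub>E (topspace X) S)"
    unfolding openin_PiE_gen by (auto simp: S_def)
  moreover have "{g \<in> topspace (Cp X). \<forall>z\<in>F. \<bar>g z - f z\<bar> < \<epsilon>} =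
      Pi\<^sub>E (topspace X) S \<inter> {f. continuous_map X euclideanreal f}"
    using F(2) by (auto simp: Cp_def S_def PiE_iff extensional_def dist_real_def abs_minus_commute split: if_splits)
  ultimately show ?thesis unfolding Cp_def openin_subtopology by blast
qed

lemma limitin_Cp:
  assumes s: "\<And>n. s n \<in> topspace (Cp X)" and f: "f \<in> topspace (Cp X)"
    and lim: "\<And>z. z \<in> topspace X \<Longrightarrow> (\<lambda>n. s n z) \<longlonglongrightarrow> f z"
  shows "limitin (Cp X) s f sequentially"
  using assms by (auto simp: Cp_def limitin_subtopology limitin_componentwise PiE_iff)

lemma productively_frechet_urysohn_unbounded_tower:
  fixes x :: "nat set \<Rightarrow> nat set"
  assumes tow: "tower aleph1 x" and unb: "unbounded_sets (x ` Field aleph1)"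
  shows "productively_frechet_urysohn TYPE('b)
    (Cp (subtopology cantor_topology (x ` Field aleph1 \<union> Fin)))"
  unfolding productively_frechet_urysohn_def
proof (intro allI impI)
  fix Y :: "'b topology" assume sfu: "strongly_frechet_urysohn Y"
  define X where "X = subtopology cantor_topology (x ` Field aleph1 \<union> Fin)"
  have topX: "topspace X = x ` Field aleph1 \<union> Fin" by (simp add: X_def)
  have "\<exists>s. (\<forall>n::nat. s n \<in> A) \<and> limitin (prod_topology (Cp X) Y) s q sequentially"
    if A: "A \<subseteq> topspace (prod_topology (Cp X) Y)" and q: "q \<in> prod_topology (Cp X) Y closure_of A"
    for A q
  proof -
    obtain f p where fp: "q = (f, p)" by (cases q)
    have f: "f \<in> topspace (Cp X)" and p: "p \<in> topspace Y"
      using q fp by (auto simp: in_closure_of)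
    have cont: "continuous_map X euclideanreal g" if "g \<in> topspace (Cp X)" for g
      using that by (auto simp: Cp_def)
    define Big where "Big B \<longleftrightarrow> p \<in> Y closure_of (snd ` B)" for B :: "((nat set \<Rightarrow> real) \<times> 'b) set"
    define Conv where "Conv s \<longleftrightarrow> limitin Y (snd \<circ> s) p sequentially"
      for s :: "nat \<Rightarrow> (nat set \<Rightarrow> real) \<times> 'b"
    \<comment> \<open>\<open>Suc n\<close> keeps the tolerance positive at \<open>n = 0\<close>; the
      tolerances tend to \<open>0\<close>, so eventual membership in \<open>G (s j) j\<close> is
      pointwise convergence at rate \<open>1 / (j + 1)\<close>.\<close>
    define G where "G e n = {z \<in> topspace X. \<bar>fst e z - f z\<bar> < inverse (real (Suc n))}"
      for e :: "(nat set \<Rightarrow> real) \<times> 'b" and n :: nat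
    obtain s where sA: "\<And>j. s j \<in> A" and sC: "Conv s"
      and sG: "\<And>z. z \<in> x ` Field aleph1 \<union> Fin \<Longrightarrow> \<forall>\<^sub>F j in sequentially. z \<in> G (s j) j"
    proof (rule tower_selection[OF Well_order_aleph1 uncountable_Field_aleph1
          countable_under_aleph1 tow unb, of Big A Conv G])
      show "Big C" if "Big B" "B \<subseteq> C" "C \<subseteq> A" for B C
        using that closure_of_mono[of "snd ` B" "snd ` C" Y] unfolding Big_def by blast
      show "\<exists>s. (\<forall>n. s n \<in> B n) \<and> Conv s"
        if B: "decseq B" "\<And>n. B n \<subseteq> A" "\<And>n. Big (B n)" for B
      proof -
        have "decseq (\<lambda>n. snd ` B n)" using B(1) unfolding decseq_def by blast
        moreover have "snd ` B n \<subseteq> topspace Y" for n using B(2)[of n] A by auto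
        ultimately obtain t where t: "\<And>n. t n \<in> snd ` B n" "limitin Y t p sequentially"
          using sfu B(3) unfolding strongly_frechet_urysohn_def Big_def by metis
        have "\<forall>n. \<exists>e. e \<in> B n \<and> t n = snd e" using t(1) by blast
        then obtain s where s: "\<And>n. s n \<in> B n" "\<And>n. t n = snd (s n)" by metis
        then have "snd \<circ> s = t" by auto
        with s t(2) show ?thesis by (intro exI[of _ s]) (auto simp: Conv_def)
      qed
      show "Big (s ` D)" if s: "Conv s" and D: "infinite D" for s D
        unfolding Big_def in_closure_of
      proof (intro conjI allI impI p)
        fix W assume "p \<in> W \<and> openin Y W"
        then obtain N where N: "\<And>n. n \<ge> N \<Longrightarrow> snd (s n) \<in> W"
          using s by (auto simp: Conv_def limitin_def eventually_sequentially)
        obtain n where "n \<in> D" "n \<ge> N" using D infinite_nat_iff_unbounded_le by blast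
        with N show "\<exists>y. y \<in> snd ` s ` D \<and> y \<in> W" by blast
      qed
      show "decseq (G e)" for e
      proof (rule decseq_SucI)
        fix n
        have "inverse (real (Suc (Suc n))) \<le> inverse (real (Suc n))"
          by (intro le_imp_inverse_le) auto
        then show "G e (Suc n) \<subseteq> G e n" unfolding G_def by (blast intro: less_le_trans)
      qed
      show "Big {e \<in> A. F \<subseteq> G e n \<and>
          (\<exists>m. \<forall>z\<in>x ` Field aleph1 \<union> Fin. z \<inter> {n..<m} = {} \<longrightarrow> z \<in> G e n)}"
        if F: "finite F" "F \<subseteq> x ` Field aleph1 \<union> Fin" for F n
        unfolding Big_def in_closure_of
      proof (intro conjI allI impI p)
        fix W assume W: "p \<in> W \<and> openin Y W"
        let ?F = "F \<union> Pow {..<n}"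
        \<comment> \<open>The neighbourhood \<open>N \<times> W\<close> of \<open>q\<close> meets
          \<open>A\<close>, producing a pair close to \<open>f\<close> on \<open>F\<close> and on
          \<open>Pow {..<n}\<close> with second component in \<open>W\<close>.\<close>
        define N where
          "N = {g \<in> topspace (Cp X). \<forall>z\<in>?F. \<bar>g z - f z\<bar> < inverse (real (Suc n))}"
        note P = Pow_lessThan_subset_Fin[of n]
        have finF: "finite ?F" "?F \<subseteq> topspace X" using F topX P by auto
        then have "openin (Cp X) N" unfolding N_def by (rule openin_Cp_uniform_on_finite)
        then have "openin (prod_topology (Cp X) Y) (N \<times> W)"
          using W by (simp add: openin_prod_Times_iff)
        moreover have "q \<in> N \<times> W" using f W fp by (simp add: N_def)
        moreover have "q \<in> U \<and> openin (prod_topology (Cp X) Y) U \<Longrightarrow> \<exists>e. e \<in> A \<and> e \<in> U" for U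
          using q by (simp add: in_closure_of)
        ultimately have "\<exists>e. e \<in> A \<and> e \<in> N \<times> W" by metis
        then obtain e where e: "e \<in> A" "fst e \<in> N" "snd e \<in> W" by auto
        have FG: "?F \<subseteq> G e n" using e(2) finF by (auto simp: G_def N_def)
        \<comment> \<open>Continuity of the difference makes \<open>G e n\<close> open, which turns
          closeness on \<open>Pow {..<n}\<close> into closeness on every point missing a
          gap.\<close>
        have "continuous_map X euclideanreal (\<lambda>z. fst e z - f z)"
          using e(2) f by (intro continuous_map_diff cont) (auto simp: N_def)
        then have "openin X {z \<in> topspace X. fst e z - f z \<in> ball 0 (inverse (real (Suc n)))}"
          by (rule openin_continuous_map_preimage) auto
        moreover have "{z \<in> topspace X. fst e z - f z \<in> ball 0 (inverse (real (Suc n)))} = G e n"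
          by (simp add: G_def dist_real_def abs_minus_commute)
        ultimately have "openin X (G e n)" by simp
        then have "\<exists>m. \<forall>z\<in>x ` Field aleph1 \<union> Fin. z \<inter> {n..<m} = {} \<longrightarrow> z \<in> G e n"
          using FG unfolding X_def by (intro openin_cantor_gap) auto
        with e FG show "\<exists>y. y \<in> snd ` {e \<in> A. F \<subseteq> G e n \<and>
            (\<exists>m. \<forall>z\<in>x ` Field aleph1 \<union> Fin. z \<inter> {n..<m} = {} \<longrightarrow> z \<in> G e n)} \<and> y \<in> W"
          by (intro exI[of _ "snd e"]) auto
      qed
    qed blast
    have "limitin (Cp X) (fst \<circ> s) f sequentially"
    proof (rule limitin_Cp[OF _ f])
      show "(fst \<circ> s) n \<in> topspace (Cp X)" for n using sA[of n] A by auto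
      fix z assume "z \<in> topspace X"
      then have "\<forall>\<^sub>F j in sequentially. norm (fst (s j) z - f z) \<le> inverse (real (Suc j))"
        using sG[of z] topX by (auto simp: G_def elim: eventually_mono)
      then have "(\<lambda>j. fst (s j) z - f z) \<longlonglongrightarrow> 0"
        by (rule Lim_null_comparison[OF _ LIMSEQ_inverse_real_of_nat])
      then show "(\<lambda>j. (fst \<circ> s) j z) \<longlonglongrightarrow> f z" by (simp add: LIM_zero_iff)
    qed
    then have "limitin (prod_topology (Cp X) Y) s q sequentially"
      using sC by (simp add: limitin_pairwise fp Conv_def)
    with sA show ?thesis by blast
  qed
  then show "frechet_urysohn
      (prod_topology (Cp (subtopology cantor_topology (x ` Field aleph1 \<union> Fin))) Y)"
    unfolding frechet_urysohn_def X_def by blast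
qed

theorem theorem2p8:
  fixes x :: "nat set \<Rightarrow> nat set" and T :: "nat set set"
  assumes "T = x ` Field aleph1"
    and "tower aleph1 x"
    and "unbounded_sets T"
  shows "productively_frechet_urysohn TYPE('b) (Cp (subtopology cantor_topology (T \<union> Fin))) \<and>
         productively_gamma TYPE('c) (subtopology cantor_topology (T \<union> Fin))"
  using assms productively_frechet_urysohn_unbounded_tower productively_gamma_unbounded_tower
  by blast

end
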